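(* Let $q$ be a prime power, let $n$ be a positive integer with $\gcd(n,q)=1$, let $\lambda\in\mathbb{F}_q^*$ have multiplicative order $o_\lambda$, and let $m_2=\operatorname{ord}_{n o_\lambda}(q)$, so that $\mathbb{F}_{q^{m_2}}$ is the splitting field of $x^n-\lambda$ over $\mathbb{F}_q$. Let $\xi$ be a primitive $n$-th root of unity and let $\beta\in\mathbb{F}_{q^{m_2}}$ be an $n$-th root of $\lambda$. Let $\mathbf{A}=(A_0,\ldots,A_{n-1})\in\mathbb{F}_{q^{m_2}}^n$, let $\mathbf{a}=\mathcal{F}_{\xi,\beta}^{-1}(\mathbf{A})$, and let $t\in\mathbb{Z}_n$ satisfy $\xi^t=\beta^{q-1}$. Then $\mathbf{a}\in\mathbb{F}_q^n$ if and only if $A_j^q=A_{qj+t}$ for all $j\in\mathbb{Z}_n$ (indices taken modulo $n$).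
   Context: The $\lambda$-constacyclic DFT with respect to $\xi,\beta$ sends $\mathbf{a}=(a_0,\ldots,a_{n-1})$ to $\mathbf{A}=\mathcal{F}_{\xi,\beta}(\mathbf{a})$ with $A_j=\sum_{i=0}^{n-1}a_i(\xi^j\beta)^i$, and its inverse $\mathcal{F}_{\xi,\beta}^{-1}$ sends $\mathbf{A}$ to the vector $\mathbf{a}$ with $a_i=\frac{1}{n\beta^i}\sum_{j=0}^{n-1}A_j\xi^{-ij}$. *)

theory Defs
  imports "HOL-Algebra.Subrings" "HOL-Number_Theory.Number_Theory"
begin

(* Two library theories define a constant mult_of; the qualified name keeps terms
   stable for theories that also import Ring_Divisibility. *)
definition mult_order :: "('a, 'b) ring_scheme \<Rightarrow> 'a \<Rightarrow> nat" where
  "mult_order K x = group.ord (Multiplicative_Group.mult_of K) x"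

definition primitive_root_of_unity :: "('a, 'b) ring_scheme \<Rightarrow> nat \<Rightarrow> 'a \<Rightarrow> bool" where
  "primitive_root_of_unity K n x \<longleftrightarrow>
     x \<in> carrier K - {\<zero>\<^bsub>K\<^esub>} \<and> mult_order K x = n"

(* Vectors of length n are functions on nat of which only the values at
   0, ..., n - 1 matter.  The integer n in the denominator is read in K as the
   n-fold sum of the unit. *)
definition constacyclic_dft ::
    "('a, 'b) ring_scheme \<Rightarrow> nat \<Rightarrow> 'a \<Rightarrow> 'a \<Rightarrow> (nat \<Rightarrow> 'a) \<Rightarrow> nat \<Rightarrow> 'a" where
  "constacyclic_dft K n \<xi> \<beta> a j =
     (\<Oplus>\<^bsub>K\<^esub>i\<in>{..<n}. a i \<otimes>\<^bsub>K\<^esub> (\<xi> [^]\<^bsub>K\<^esub> j \<otimes>\<^bsub>K\<^esub> \<beta>) [^]\<^bsub>K\<^esub> i)"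

definition constacyclic_idft ::
    "('a, 'b) ring_scheme \<Rightarrow> nat \<Rightarrow> 'a \<Rightarrow> 'a \<Rightarrow> (nat \<Rightarrow> 'a) \<Rightarrow> nat \<Rightarrow> 'a" where
  "constacyclic_idft K n \<xi> \<beta> A i =
     inv\<^bsub>K\<^esub> ([n] \<cdot>\<^bsub>K\<^esub> \<one>\<^bsub>K\<^esub> \<otimes>\<^bsub>K\<^esub> \<beta> [^]\<^bsub>K\<^esub> i) \<otimes>\<^bsub>K\<^esub>
     (\<Oplus>\<^bsub>K\<^esub>j\<in>{..<n}. A j \<otimes>\<^bsub>K\<^esub> \<xi> [^]\<^bsub>K\<^esub> (- int (i * j)))"

end

(* The field F is the fixed set of the Frobenius map x |-> x^q of K.  Since
   (xi^j beta)^q = xi^(qj+t) beta, Frobenius applied to a transform of a vector over F moves the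
   j-th entry to position qj+t.  Conversely, if A_j^q = A_(qj+t), then raising the inverse transform
   to the q-th power only permutes its summands along the bijection j |-> qj+t of Z_n. *)
theory Submission
  imports Defs
begin

section \<open>Finite sums, the binomial theorem and the Frobenius endomorphism\<close>

lemma (in abelian_monoid) finsum_swap:
  assumes "finite A" and "finite B"
    and "\<And>i j. i \<in> A \<Longrightarrow> j \<in> B \<Longrightarrow> f i j \<in> carrier G"
  shows "(\<Oplus>i\<in>A. \<Oplus>j\<in>B. f i j) = (\<Oplus>j\<in>B. \<Oplus>i\<in>A. f i j)"
  using assms(1,3)
proof (induction A rule: finite_induct)
  case empty
  then show ?case by simp
next
  case (insert a A)
  have "(\<Oplus>i\<in>insert a A. \<Oplus>j\<in>B. f i j) = (\<Oplus>j\<in>B. f a j) \<oplus> (\<Oplus>i\<in>A. \<Oplus>j\<in>B. f i j)"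
    using insert.hyps insert.prems by (intro finsum_insert) (auto intro!: finsum_closed)
  also have "\<dots> = (\<Oplus>j\<in>B. f a j) \<oplus> (\<Oplus>j\<in>B. \<Oplus>i\<in>A. f i j)"
    using insert by simp
  also have "\<dots> = (\<Oplus>j\<in>B. f a j \<oplus> (\<Oplus>i\<in>A. f i j))"
    using insert.prems by (intro finsum_addf [symmetric]) (auto intro!: finsum_closed)
  also have "\<dots> = (\<Oplus>j\<in>B. \<Oplus>i\<in>insert a A. f i j)"
    using insert.hyps insert.prems
    by (intro finsum_cong' finsum_insert [symmetric]) (auto intro!: finsum_closed)
  finally show ?case .
qed

text \<open>Multiplying the expansion for \<open>n\<close> by \<open>x \<oplus> y\<close> gives two
  sums; once one of them is shifted by an index, Pascal's rule merges their coefficients.\<close>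

lemma (in cring) binomial_theorem:
  assumes x: "x \<in> carrier R" and y: "y \<in> carrier R"
  shows "(x \<oplus> y) [^] n = (\<Oplus>k\<in>{..n}. [(n choose k)] \<cdot> (x [^] k \<otimes> y [^] (n - k)))"
proof (induction n)
  case 0
  then show ?case by simp
next
  case (Suc n)
  let ?S = "\<lambda>g. \<Oplus>k\<in>{..n::nat}. g k"
  \<comment> \<open>\<open>f\<close> and \<open>g\<close> are the terms for exponent
    \<open>n\<close> after multiplication by \<open>x\<close> and by \<open>y\<close>;
    \<open>h\<close> collects the terms wanted for \<open>Suc n\<close>.\<close>
  define f where "f k = [(n choose k)] \<cdot> (x [^] Suc k \<otimes> y [^] (n - k))" for k
  define g where "g k = [(n choose k)] \<cdot> (x [^] k \<otimes> y [^] (Suc n - k))" for k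
  define h where "h k = [(Suc n choose k)] \<cdot> (x [^] k \<otimes> y [^] (Suc n - k))" for k
  have closed: "f k \<in> carrier R" "g k \<in> carrier R" "h k \<in> carrier R" for k
    using x y by (simp_all add: f_def g_def h_def del: nat_pow_Suc)
  have h_Suc: "h (Suc k) = f k \<oplus> g (Suc k)" for k
    using x y by (simp add: f_def g_def h_def add.nat_pow_mult [symmetric] del: nat_pow_Suc)
  have fx: "[(n choose k)] \<cdot> (x [^] k \<otimes> y [^] (n - k)) \<otimes> x = f k" for k
    using x y by (simp add: f_def add_pow_ldistr add_pow_rdistr m_ac)
  have gy: "[(n choose k)] \<cdot> (x [^] k \<otimes> y [^] (n - k)) \<otimes> y = g k" if "k \<le> n" for k
    using x y that by (simp add: g_def add_pow_ldistr add_pow_rdistr m_ac Suc_diff_le)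
  have "(x \<oplus> y) [^] Suc n = ?S (\<lambda>k. [(n choose k)] \<cdot> (x [^] k \<otimes> y [^] (n - k))) \<otimes> x
      \<oplus> ?S (\<lambda>k. [(n choose k)] \<cdot> (x [^] k \<otimes> y [^] (n - k))) \<otimes> y"
    using x y by (simp add: Suc.IH r_distr)
  also have "\<dots> = ?S f \<oplus> ?S g"
    using x y closed by (simp add: finsum_ldistr fx gy cong: finsum_cong)
  \<comment> \<open>Appending the term at \<open>Suc n\<close>, whose coefficient is zero, allows
    index 0 to be split off instead; the remaining terms \<open>g (Suc k)\<close> then line up with
    \<open>f k\<close>.\<close>
  also have "?S g = (\<Oplus>k\<in>{..Suc n}. g k)"
  proof -
    have "g (Suc n) = \<zero>"
      using x y by (simp add: g_def binomial_eq_0 del: nat_pow_Suc)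
    then show ?thesis
      using closed by (subst finsum_Suc) auto
  qed
  also have "\<dots> = ?S (\<lambda>k. g (Suc k)) \<oplus> g 0"
    using closed by (intro finsum_Suc2) auto
  also have "?S f \<oplus> (?S (\<lambda>k. g (Suc k)) \<oplus> g 0) = ?S (\<lambda>k. h (Suc k)) \<oplus> h 0"
    using closed by (simp add: h_Suc finsum_addf a_assoc) (simp add: g_def h_def)
  also have "\<dots> = (\<Oplus>k\<in>{..Suc n}. h k)"
    using closed by (intro finsum_Suc2 [symmetric]) auto
  finally show ?case by (simp only: h_def)
qed

text \<open>A prime \<open>p\<close> divides every binomial coefficient strictly between the two
  ends of its row, so only the two outer terms of the expansion survive.\<close>

lemma (in cring) freshmans_dream:
  fixes p :: nat
  assumes p: "prime p" and char: "[p] \<cdot> \<one> = \<zero>" and x: "x \<in> carrier R" and y: "y \<in> carrier R"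
  shows "(x \<oplus> y) [^] p = x [^] p \<oplus> y [^] p"
proof -
  define h where "h k = [(p choose k)] \<cdot> (x [^] k \<otimes> y [^] (p - k))" for k
  have closed: "h k \<in> carrier R" for k
    using x y by (simp add: h_def)
  \<comment> \<open>With this form of \<open>p\<close> the inner indices 1, ..., p - 1 are exactly
    \<open>Suc k\<close> for \<open>k \<le> m\<close>.\<close>
  obtain m where m: "p = Suc (Suc m)"
    using prime_ge_2_nat [OF p] by (metis add_2_eq_Suc le_Suc_ex)
  have mult_zero: "[p] \<cdot> z = \<zero>" if "z \<in> carrier R" for z
    using add_pow_ldistr [of \<one> z p] char that by simp
  have middle: "h (Suc k) = \<zero>" if "k \<le> m" for k
  proof -
    have "p dvd (p choose Suc k)"
      using that m p by (intro dvd_choose_prime) auto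
    then obtain c where "(p choose Suc k) = p * c" ..
    then show ?thesis
      using x y mult_zero by (simp add: h_def add.nat_pow_pow [symmetric] mult.commute [of p])
  qed
  have "(x \<oplus> y) [^] p = (\<Oplus>k\<in>{..Suc (Suc m)}. h k)"
    using binomial_theorem [OF x y, of p] m by (simp add: h_def)
  also have "\<dots> = h p \<oplus> (\<Oplus>k\<in>{..Suc m}. h k)"
    using closed m by (simp only: finsum_Suc Pi_I)
  also have "(\<Oplus>k\<in>{..Suc m}. h k) = (\<Oplus>k\<in>{..m}. h (Suc k)) \<oplus> h 0"
    using closed by (intro finsum_Suc2) auto
  also have "(\<Oplus>k\<in>{..m}. h (Suc k)) = (\<Oplus>k\<in>{..m}. \<zero>)"
    by (intro finsum_cong') (auto simp: middle)
  finally show ?thesis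
    using x y by (simp add: h_def)
qed

lemma (in cring) freshmans_dream_power:
  fixes p :: nat
  assumes p: "prime p" and char: "[p] \<cdot> \<one> = \<zero>" and x: "x \<in> carrier R" and y: "y \<in> carrier R"
  shows "(x \<oplus> y) [^] (p ^ k) = x [^] (p ^ k) \<oplus> y [^] (p ^ k)"
proof (induction k)
  case 0
  then show ?case using x y by (simp add: nat_pow_eone)
next
  case (Suc k)
  have "(x \<oplus> y) [^] (p ^ Suc k) = ((x \<oplus> y) [^] (p ^ k)) [^] p"
    using x y by (simp add: nat_pow_pow mult.commute)
  also have "\<dots> = (x [^] (p ^ k)) [^] p \<oplus> (y [^] (p ^ k)) [^] p"
    using x y Suc freshmans_dream [OF p char] by simp
  finally show ?case
    using x y by (simp add: nat_pow_pow mult.commute)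
qed

text \<open>Packaged as a \<open>ring_hom_cring\<close>, the map can be pushed through finite sums
  by \<open>hom_finsum\<close>.\<close>

lemma (in cring) frobenius_hom:
  fixes p :: nat
  assumes "prime p" and "[p] \<cdot> \<one> = \<zero>"
  shows "ring_hom_cring R R (\<lambda>x. x [^] (p ^ k))"
  using assms
  by unfold_locales (auto intro!: ring_hom_memI simp: freshmans_dream_power nat_pow_distrib)

section \<open>Characteristic, invertibility of \<open>n\<close>, and the subfield as a fixed
  set\<close>

text \<open>The order of the additive group annihilates \<open>\<one>\<close>, so a product of
  \<open>k\<close> factors \<open>[p] \<cdot> \<one>\<close> vanishes; in a domain one factor must
  then vanish.\<close>

lemma (in domain) prime_char_of_card:
  fixes p :: nat
  assumes p: "prime p" and card: "card (carrier R) = p ^ k"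
  shows "[p] \<cdot> \<one> = \<zero>"
proof -
  have "[(order (add_monoid R))] \<cdot> \<one> = \<zero>"
    using add.pow_order_eq_1 [of \<one>] by simp
  then have "[(p ^ k)] \<cdot> \<one> = \<zero>"
    by (simp add: order_def card)
  then show ?thesis
  proof (induction k)
    case 0
    then show ?case by simp
  next
    case (Suc k)
    have "[p] \<cdot> \<one> \<otimes> [(p ^ k)] \<cdot> \<one> = [(p ^ Suc k)] \<cdot> \<one>"
      by (simp add: add_pow_ldistr add.nat_pow_pow mult.commute)
    then show ?case
      using Suc integral [of "[p] \<cdot> \<one>" "[(p ^ k)] \<cdot> \<one>"] by auto
  qed
qed

text \<open>The additive order of \<open>\<one>\<close> would divide both \<open>n\<close> and
  \<open>p\<close>, hence be 1, giving \<open>\<one> = \<zero>\<close>. This makes the denominator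
  of the inverse transform invertible.\<close>

lemma (in domain) add_pow_one_nonzero:
  fixes n p :: nat
  assumes "[p] \<cdot> \<one> = \<zero>" and "coprime n p"
  shows "[n] \<cdot> \<one> \<noteq> \<zero>"
proof
  assume "[n] \<cdot> \<one> = \<zero>"
  then have "add.ord \<one> dvd n" and "add.ord \<one> dvd p"
    using assms(1) add.pow_eq_id [of \<one>] by auto
  then have "add.ord \<one> = 1"
    using assms(2) by (metis coprime_common_divisor_nat)
  then show False
    using add.ord_eq_1 [of \<one>] by simp
qed

text \<open>Nonzero elements of \<open>F\<close> are roots of x^(q-1) = 1, which has at most q - 1
  roots in the whole field. There are q - 1 such elements, so they are all the roots.\<close>

lemma (in field) finite_subfield_fixed_points:
  assumes finite: "finite (carrier R)" and F: "subfield F R" and card: "card F = q"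
  shows "F = {x \<in> carrier R. x [^] q = x}"
proof -
  let ?U = "{x \<in> carrier R. x [^] (q - 1) = \<one>}"
  have FR: "F \<subseteq> carrier R" and zero: "\<zero> \<in> F"
    using subfieldE(3) [OF F] subringE(2) [OF subfieldE(1) [OF F]] by auto
  have one: "\<one> \<in> F"
    using subringE(3) [OF subfieldE(1) [OF F]] .
  have fin: "finite F"
    using FR finite by (rule finite_subset)
  \<comment> \<open>Having \<open>q > 1\<close> makes \<open>q - 1\<close> a nonzero exponent, as
    the bound on the number of roots demands.\<close>
  have "card {\<zero>, \<one>} \<le> card F"
    using fin zero one by (intro card_mono) auto
  then have q: "q > 1"
    using card by simp
  interpret F: field "R\<lparr>carrier := F\<rparr>"
    using subfield_iff(2) [OF F] .
  interpret FU: group "mult_of (R\<lparr>carrier := F\<rparr>)"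
    by (rule F.field_mult_group)
  have sub: "F - {\<zero>} \<subseteq> ?U"
  proof
    fix x assume "x \<in> F - {\<zero>}"
    then show "x \<in> ?U"
      using FU.pow_order_eq_1 [of x] F.order_mult_of FR fin card
      by (auto simp: order_def nat_pow_mult_of nat_pow_consistent [symmetric])
  qed
  have eq: "F - {\<zero>} = ?U"
  proof (rule card_seteq)
    show "card ?U \<le> card (F - {\<zero>})"
      using num_roots_le_deg [OF finite, of "q - 1"] q card fin zero by simp
  qed (use finite sub in auto)
  have pow_q: "x [^] q = x [^] (q - 1) \<otimes> x" if "x \<in> carrier R" for x
    using q that by (cases q) auto
  have "x [^] q = x \<longleftrightarrow> x = \<zero> \<or> x [^] (q - 1) = \<one>" if "x \<in> carrier R" for x
    using that by (metis pow_q l_one m_rcancel nat_pow_closed one_closed r_null)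
  then show ?thesis
    using eq FR zero by auto
qed

section \<open>Inverses of units and powers of a root of unity\<close>

lemma (in comm_monoid) inv_mult_Units:
  assumes "x \<in> Units G" and "y \<in> Units G"
  shows "inv (x \<otimes> y) = inv x \<otimes> inv y"
proof (rule comm_inv_char)
  have "x \<otimes> y \<otimes> (inv x \<otimes> inv y) = (x \<otimes> inv x) \<otimes> (y \<otimes> inv y)"
    using assms by (simp add: Units_closed m_ac)
  then show "x \<otimes> y \<otimes> (inv x \<otimes> inv y) = \<one>"
    using assms by simp
qed (use assms in \<open>auto simp: Units_closed\<close>)

lemma (in comm_monoid) inv_nat_pow:
  assumes "x \<in> Units G"
  shows "inv (x [^] (n::nat)) = inv x [^] n"
  using assms by (intro comm_inv_char) (auto simp: nat_pow_distrib [symmetric] Units_closed)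

text \<open>Replaces the negative exponents of the inverse transform by natural powers of an
  inverse, so that later computations stay with natural exponents.\<close>

lemma (in comm_monoid) int_pow_neg_int_Units:
  assumes "x \<in> Units G"
  shows "x [^] (- int n) = inv x [^] n"
  using assms by (auto simp: int_pow_def2 inv_nat_pow)

text \<open>The geometric sum times \<open>z \<ominus> \<one>\<close> telescopes to
  \<open>z [^] n \<ominus> \<one>\<close>, which is zero; the nonzero factor cancels in a
  domain.\<close>

lemma (in domain) sum_powers_root_of_unity:
  fixes n :: nat
  assumes z: "z \<in> carrier R" and "z [^] n = \<one>" and "z \<noteq> \<one>"
  shows "(\<Oplus>i\<in>{..<n}. z [^] i) = \<zero>"
proof -
  have "(\<Oplus>i\<in>{..<m}. z [^] i) \<otimes> (z \<ominus> \<one>) = z [^] m \<ominus> \<one>" for m :: nat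
  proof (induction m)
    case 0
    then show ?case using z by (simp add: minus_eq r_neg)
  next
    case (Suc m)
    have "(\<Oplus>i\<in>{..<Suc m}. z [^] i) = z [^] m \<oplus> (\<Oplus>i\<in>{..<m}. z [^] i)"
      using z by (simp add: lessThan_Suc)
    then have "(\<Oplus>i\<in>{..<Suc m}. z [^] i) \<otimes> (z \<ominus> \<one>)
        = z [^] m \<otimes> (z \<ominus> \<one>) \<oplus> (z [^] m \<ominus> \<one>)"
      using z Suc by (simp add: l_distr)
    also have "\<dots> = z [^] Suc m \<ominus> \<one>"
      using z by (simp add: minus_eq r_distr r_minus a_assoc r_neg1)
    finally show ?case .
  qed
  from this [of n] have "(\<Oplus>i\<in>{..<n}. z [^] i) \<otimes> (z \<ominus> \<one>) = \<zero>"
    using assms by simp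
  then show ?thesis
    using z \<open>z \<noteq> \<one>\<close> by (auto simp: integral_iff)
qed

lemma (in field) primitive_root_pow_eq_iff:
  fixes i j :: nat
  assumes "primitive_root_of_unity R n \<xi>"
  shows "\<xi> [^] i = \<xi> [^] j \<longleftrightarrow> [i = j] (mod n)"
proof -
  interpret M: group "mult_of R"
    by (rule field_mult_group)
  have \<xi>: "\<xi> \<in> carrier (mult_of R)" "M.ord \<xi> = n"
    using assms by (auto simp: primitive_root_of_unity_def mult_order_def)
  show ?thesis
    \<comment> \<open>The order is that of the multiplicative group, where equality of integer
      powers is divisibility of the exponent difference; this is carried over to natural powers in
      the ring.\<close>
    using M.int_pow_eq [OF \<xi>(1), of "int i" "int j"] \<xi>(2)
    by (simp add: int_pow_int nat_pow_mult_of flip: cong_int_iff)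
      (metis cong_iff_dvd_diff cong_sym_eq)
qed

section \<open>The inverse transform and Fourier inversion\<close>

lemma (in field) constacyclic_idft_eq:
  assumes "[n] \<cdot> \<one> \<noteq> \<zero>" and "\<xi> \<in> Units R" and "\<beta> \<in> Units R" and "\<And>j. j < n \<Longrightarrow> A j \<in> carrier R"
  shows "constacyclic_idft R n \<xi> \<beta> A i =
    inv ([n] \<cdot> \<one>) \<otimes> inv \<beta> [^] i \<otimes> (\<Oplus>j\<in>{..<n}. A j \<otimes> inv \<xi> [^] (i * j))"
proof -
  have N: "[n] \<cdot> \<one> \<in> Units R"
    using assms by (simp add: field_Units)
  have "inv ([n] \<cdot> \<one> \<otimes> \<beta> [^] i) = inv ([n] \<cdot> \<one>) \<otimes> inv (\<beta> [^] i)"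
    using N assms(3) m_comm by (simp add: inv_mult_Units Units_pow_closed)
  then show ?thesis
    unfolding constacyclic_idft_def
    using assms(2,3) by (simp only: int_pow_neg_int_Units inv_nat_pow)
qed

lemma (in field) constacyclic_idft_closed:
  assumes "[n] \<cdot> \<one> \<noteq> \<zero>" and "\<xi> \<in> Units R" and "\<beta> \<in> Units R" and "\<And>j. j < n \<Longrightarrow> A j \<in> carrier R"
  shows "constacyclic_idft R n \<xi> \<beta> A i \<in> carrier R"
proof -
  have "inv ([n] \<cdot> \<one>) \<in> carrier R"
    using assms(1) by (simp add: field_Units)
  then show ?thesis
    using assms constacyclic_idft_eq [OF assms] by (auto intro!: finsum_closed)
qed

text \<open>Orthogonality: after the powers of \<open>\<beta>\<close> cancel, exchanging the sums
  leaves for each \<open>k\<close> the geometric sum of \<xi>^(j-k), which is \<open>n\<close> for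
  \<open>k = j\<close> and zero otherwise.\<close>

lemma (in field) constacyclic_dft_idft:
  assumes N: "[n] \<cdot> \<one> \<noteq> \<zero>" and \<xi>: "primitive_root_of_unity R n \<xi>" and \<beta>: "\<beta> \<in> Units R"
    and A: "\<And>j. j < n \<Longrightarrow> A j \<in> carrier R" and j: "j < n"
  shows "constacyclic_dft R n \<xi> \<beta> (constacyclic_idft R n \<xi> \<beta> A) j = A j"
proof -
  let ?N = "[n] \<cdot> \<one>" and ?\<omega> = "inv \<xi>"
  have \<xi>U: "\<xi> \<in> Units R"
    using \<xi> by (simp add: primitive_root_of_unity_def field_Units)
  have NU: "?N \<in> Units R"
    using N by (simp add: field_Units)
  note closed [simp] = Units_closed [OF \<xi>U] Units_closed [OF \<beta>] Units_closed [OF NU]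
    Units_inv_closed [OF \<xi>U] Units_inv_closed [OF \<beta>] Units_inv_closed [OF NU]
  have \<xi>n: "\<xi> [^] n = \<one>"
    using primitive_root_pow_eq_iff [OF \<xi>, of n 0] by (simp add: cong_def)
  have \<omega>n: "?\<omega> [^] n = \<one>"
    using inv_nat_pow [OF \<xi>U, of n] \<xi>n by simp
  \<comment> \<open>\<open>z k\<close> stands for \<xi>^(j-k), written without subtraction because
    \<open>k\<close> may exceed \<open>j\<close>.\<close>
  define z where "z k = \<xi> [^] j \<otimes> ?\<omega> [^] k" for k :: nat
  have zc [simp]: "z k \<in> carrier R" for k
    by (simp add: z_def)
  have z_n: "z k [^] n = \<one>" for k
  proof -
    have "z k [^] n = (\<xi> [^] n) [^] j \<otimes> (?\<omega> [^] n) [^] k"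
      by (simp add: z_def nat_pow_distrib nat_pow_pow mult.commute)
    then show ?thesis
      by (simp add: \<xi>n \<omega>n)
  qed
  \<comment> \<open>Both indices lie below \<open>n\<close>, so congruence modulo \<open>n\<close>
    becomes equality.\<close>
  have z_1: "z k = \<one> \<longleftrightarrow> j = k" if "k < n" for k
  proof -
    have "z k \<otimes> \<xi> [^] k = \<xi> [^] j"
      using \<xi>U by (simp add: z_def m_assoc nat_pow_distrib [symmetric] Units_l_inv)
    then have "z k = \<one> \<longleftrightarrow> \<xi> [^] j = \<xi> [^] k"
      using \<xi>U by (metis Units_l_cancel Units_pow_closed l_one m_comm nat_pow_closed one_closed
          r_one zc closed(1))
    then show ?thesis
      using primitive_root_pow_eq_iff [OF \<xi>, of j k] that j by (simp add: cong_def)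
  qed
  have sum_z: "(\<Oplus>i\<in>{..<n}. z k [^] i) = (if j = k then ?N else \<zero>)" if "k < n" for k
  proof (cases "j = k")
    case True
    then have "z k = \<one>"
      using z_1 that by simp
    then show ?thesis
      using True add.finprod_const [of \<one> "{..<n}"] by simp
  next
    case False
    then show ?thesis
      using sum_powers_root_of_unity [OF zc z_n] z_1 that by simp
  qed
  have term_eq: "constacyclic_idft R n \<xi> \<beta> A i \<otimes> (\<xi> [^] j \<otimes> \<beta>) [^] i
      = inv ?N \<otimes> (\<Oplus>k\<in>{..<n}. A k \<otimes> z k [^] i)" for i
  proof -
    let ?S = "\<Oplus>k\<in>{..<n}. A k \<otimes> ?\<omega> [^] (i * k)"
    have S: "?S \<in> carrier R"
      using A by (auto intro!: finsum_closed)
    have \<beta>1: "inv \<beta> [^] i \<otimes> \<beta> [^] i = \<one>"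
      using \<beta> by (simp add: nat_pow_distrib [symmetric] Units_l_inv)
    have "constacyclic_idft R n \<xi> \<beta> A i \<otimes> (\<xi> [^] j \<otimes> \<beta>) [^] i
        = (inv ?N \<otimes> inv \<beta> [^] i \<otimes> ?S) \<otimes> ((\<xi> [^] j) [^] i \<otimes> \<beta> [^] i)"
      using constacyclic_idft_eq [OF N \<xi>U \<beta> A] by (simp add: nat_pow_distrib)
    also have "\<dots> = inv ?N \<otimes> (inv \<beta> [^] i \<otimes> \<beta> [^] i) \<otimes> (?S \<otimes> (\<xi> [^] j) [^] i)"
      using S by (simp add: m_ac)
    also have "\<dots> = inv ?N \<otimes> (?S \<otimes> (\<xi> [^] j) [^] i)"
      using S by (simp add: \<beta>1)
    also have "?S \<otimes> (\<xi> [^] j) [^] i = (\<Oplus>k\<in>{..<n}. A k \<otimes> ?\<omega> [^] (i * k) \<otimes> (\<xi> [^] j) [^] i)"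
      using A by (intro finsum_ldistr) auto
    also have "\<dots> = (\<Oplus>k\<in>{..<n}. A k \<otimes> z k [^] i)"
      using A by (intro finsum_cong')
        (auto simp: z_def nat_pow_distrib nat_pow_pow m_ac mult.commute)
    finally show ?thesis .
  qed
  have "constacyclic_dft R n \<xi> \<beta> (constacyclic_idft R n \<xi> \<beta> A) j
      = (\<Oplus>i\<in>{..<n}. inv ?N \<otimes> (\<Oplus>k\<in>{..<n}. A k \<otimes> z k [^] i))"
    by (simp only: constacyclic_dft_def term_eq)
  also have "\<dots> = inv ?N \<otimes> (\<Oplus>i\<in>{..<n}. \<Oplus>k\<in>{..<n}. A k \<otimes> z k [^] i)"
    using A by (intro finsum_rdistr [symmetric]) (auto intro!: finsum_closed)
  \<comment> \<open>With \<open>i\<close> as the inner index, \<open>A k\<close> factors out and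
    \<open>sum_z\<close> evaluates what remains.\<close>
  also have "(\<Oplus>i\<in>{..<n}. \<Oplus>k\<in>{..<n}. A k \<otimes> z k [^] i)
      = (\<Oplus>k\<in>{..<n}. \<Oplus>i\<in>{..<n}. A k \<otimes> z k [^] i)"
    using A by (intro finsum_swap) auto
  also have "\<dots> = (\<Oplus>k\<in>{..<n}. if j = k then A k \<otimes> ?N else \<zero>)"
  proof (intro finsum_cong')
    fix k assume "k \<in> {..<n}"
    then show "(\<Oplus>i\<in>{..<n}. A k \<otimes> z k [^] i) = (if j = k then A k \<otimes> ?N else \<zero>)"
      using A sum_z [of k] by (simp add: finsum_rdistr [symmetric])
  qed (use A in auto)
  also have "\<dots> = A j \<otimes> ?N"
    using A j by (intro finsum_singleton) auto
  also have "inv ?N \<otimes> (A j \<otimes> ?N) = A j"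
    using A [OF j] NU by (simp add: m_lcomm [of "inv ?N"] Units_l_inv)
  finally show ?thesis .
qed

section \<open>Frobenius acting on the transform and its inverse\<close>

text \<open>The transform is defined at every natural index; periodicity allows it to be evaluated
  at \<open>q * j + t\<close> first and the index to be reduced afterwards.\<close>

lemma (in field) constacyclic_dft_cong_mod:
  assumes "primitive_root_of_unity R n \<xi>" and "[j = k] (mod n)"
  shows "constacyclic_dft R n \<xi> \<beta> a j = constacyclic_dft R n \<xi> \<beta> a k"
  using primitive_root_pow_eq_iff [OF assms(1), of j k] assms(2)
  by (simp add: constacyclic_dft_def)

lemma (in field) constacyclic_dft_frobenius:
  fixes q :: nat
  assumes hom: "ring_hom_cring R R (\<lambda>x. x [^] q)"
    and \<xi>: "\<xi> \<in> carrier R" and \<beta>: "\<beta> \<in> carrier R" and t: "\<xi> [^] t \<otimes> \<beta> = \<beta> [^] q"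
    and a: "\<And>i. i < n \<Longrightarrow> a i \<in> carrier R" "\<And>i. i < n \<Longrightarrow> a i [^] q = a i"
  shows "constacyclic_dft R n \<xi> \<beta> a j [^] q = constacyclic_dft R n \<xi> \<beta> a (q * j + t)"
proof -
  note pow_finsum = ring_hom_cring.hom_finsum [OF hom, unfolded o_def]
  have node: "(\<xi> [^] j \<otimes> \<beta>) [^] q = \<xi> [^] (q * j + t) \<otimes> \<beta>"
    using \<xi> \<beta> by (simp add: nat_pow_distrib nat_pow_pow nat_pow_mult [symmetric] m_assoc t
        mult.commute)
  have "((\<xi> [^] j \<otimes> \<beta>) [^] i) [^] q = ((\<xi> [^] j \<otimes> \<beta>) [^] q) [^] i" for i :: nat
    using \<xi> \<beta> by (simp only: nat_pow_pow mult.commute [of i] m_closed nat_pow_closed)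
  then have "(a i \<otimes> (\<xi> [^] j \<otimes> \<beta>) [^] i) [^] q = a i \<otimes> (\<xi> [^] (q * j + t) \<otimes> \<beta>) [^] i"
    if "i < n" for i
    using that \<xi> \<beta> a by (simp add: nat_pow_distrib [of "a i"] node)
  moreover have "constacyclic_dft R n \<xi> \<beta> a j [^] q =
      (\<Oplus>i\<in>{..<n}. (a i \<otimes> (\<xi> [^] j \<otimes> \<beta>) [^] i) [^] q)"
    unfolding constacyclic_dft_def using \<xi> \<beta> a
    by (subst pow_finsum) auto
  ultimately show ?thesis
    unfolding constacyclic_dft_def using \<xi> \<beta> a by (auto intro!: finsum_cong')
qed

text \<open>Since \<open>q\<close> is cancellable modulo \<open>n\<close>, the map is injective, and
  an injective self-map of a finite set is onto.\<close>

lemma bij_betw_affine_mod: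
  fixes n q t :: nat
  assumes "n > 0" and "coprime q n"
  shows "bij_betw (\<lambda>j. (q * j + t) mod n) {..<n} {..<n}"
proof -
  have "inj_on (\<lambda>j. (q * j + t) mod n) {..<n}"
  proof (rule inj_onI)
    fix j k assume jk: "j \<in> {..<n}" "k \<in> {..<n}" "(q * j + t) mod n = (q * k + t) mod n"
    then have "[q * j = q * k] (mod n)"
      by (simp add: cong_add_rcancel_nat flip: cong_def)
    then have "[j = k] (mod n)"
      using assms(2) by (simp add: cong_mult_lcancel_nat)
    then show "j = k"
      using jk by (simp add: cong_def)
  qed
  moreover from this have "(\<lambda>j. (q * j + t) mod n) ` {..<n} = {..<n}"
    using assms(1) by (intro endo_inj_surj) auto
  ultimately show ?thesis
    by (simp add: bij_betw_def)
qed

text \<open>Frobenius fixes 1/n, and on \<beta>^(-i) it produces an extra factor \<xi>^(-ti). That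
  factor is exactly what the reindexing of the sum absorbs.\<close>

lemma (in field) constacyclic_idft_frobenius:
  fixes q :: nat
  assumes hom: "ring_hom_cring R R (\<lambda>x. x [^] q)"
    and n: "n > 0" "coprime q n"
    and N: "[n] \<cdot> \<one> \<noteq> \<zero>" and \<xi>: "primitive_root_of_unity R n \<xi>" and \<beta>: "\<beta> \<in> Units R"
    and t: "\<xi> [^] t \<otimes> \<beta> = \<beta> [^] q"
    and A: "\<And>j. j < n \<Longrightarrow> A j \<in> carrier R"
      "\<And>j. j < n \<Longrightarrow> A j [^] q = A ((q * j + t) mod n)"
  shows "constacyclic_idft R n \<xi> \<beta> A i [^] q = constacyclic_idft R n \<xi> \<beta> A i"
proof -
  note pow_finsum = ring_hom_cring.hom_finsum [OF hom, unfolded o_def]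
  let ?N = "[n] \<cdot> \<one>" and ?\<omega> = "inv \<xi>" and ?b = "inv \<beta>"
  let ?\<sigma> = "\<lambda>j. (q * j + t) mod n"
  let ?S = "\<Oplus>j\<in>{..<n}. A j \<otimes> ?\<omega> [^] (i * j)"
  have \<xi>U: "\<xi> \<in> Units R"
    using \<xi> by (simp add: primitive_root_of_unity_def field_Units)
  have NU: "?N \<in> Units R"
    using N by (simp add: field_Units)
  note closed [simp] = Units_closed [OF \<xi>U] Units_closed [OF \<beta>] Units_closed [OF NU]
    Units_inv_closed [OF \<xi>U] Units_inv_closed [OF \<beta>] Units_inv_closed [OF NU]
  have S [simp]: "?S \<in> carrier R"
    using A by (auto intro!: finsum_closed)
  \<comment> \<open>Frobenius fixes every multiple of the unit, since it is additive and fixes the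
    unit itself; the induction therefore runs over an arbitrary \<open>m\<close>.\<close>
  have "?N [^] q = ?N"
  proof -
    interpret phi: ring_hom_cring R R "\<lambda>x. x [^] q"
      by (rule hom)
    have "([m] \<cdot> \<one>) [^] q = [m] \<cdot> \<one>" for m :: nat
      by (induction m) (simp_all add: phi.hom_add)
    then show ?thesis .
  qed
  then have N_q: "inv ?N [^] q = inv ?N"
    using inv_nat_pow [OF NU, of q] by simp
  have b_q: "?b [^] q = ?\<omega> [^] t \<otimes> ?b"
    using \<xi>U \<beta>
    by (simp add: inv_nat_pow [symmetric] t [symmetric] inv_mult_Units Units_pow_closed)
  \<comment> \<open>Reducing the index modulo \<open>n\<close> does not change the power, and i(qj +
    t) = ijq + ti splits it into a Frobenius image and a factor independent of
    \<open>j\<close>.\<close>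
  have \<omega>_mod: "?\<omega> [^] (i * ?\<sigma> j) = (?\<omega> [^] (i * j)) [^] q \<otimes> (?\<omega> [^] t) [^] i" for j
  proof -
    have "[i * ?\<sigma> j = i * (q * j + t)] (mod n)"
      by (simp add: cong_def mod_mult_right_eq)
    then have "\<xi> [^] (i * ?\<sigma> j) = \<xi> [^] (i * (q * j + t))"
      using primitive_root_pow_eq_iff [OF \<xi>] by blast
    then have "?\<omega> [^] (i * ?\<sigma> j) = ?\<omega> [^] (i * (q * j + t))"
      by (metis inv_nat_pow [OF \<xi>U])
    then show ?thesis
      by (simp add: nat_pow_pow nat_pow_mult algebra_simps)
  qed
  \<comment> \<open>The factor left over from \<open>b_q\<close> is moved inside the sum, where it
    completes the \<open>j\<close>-th summand to the one at \<open>?\<sigma> j\<close>.\<close>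
  have "?S [^] q \<otimes> (?\<omega> [^] t) [^] i = (\<Oplus>j\<in>{..<n}. (A j \<otimes> ?\<omega> [^] (i * j)) [^] q) \<otimes> (?\<omega> [^] t) [^] i"
    using A by (subst pow_finsum) auto
  also have "\<dots> = (\<Oplus>j\<in>{..<n}. (A j \<otimes> ?\<omega> [^] (i * j)) [^] q \<otimes> (?\<omega> [^] t) [^] i)"
    using A by (intro finsum_ldistr) auto
  also have "\<dots> = (\<Oplus>j\<in>{..<n}. A (?\<sigma> j) \<otimes> ?\<omega> [^] (i * ?\<sigma> j))"
    using A n by (intro finsum_cong') (auto simp: nat_pow_distrib \<omega>_mod m_assoc)
  also have "\<dots> = (\<Oplus>j\<in>?\<sigma> ` {..<n}. A j \<otimes> ?\<omega> [^] (i * j))"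
    using A bij_betw_affine_mod [OF n, of t]
    by (intro finsum_reindex [symmetric]) (auto simp: bij_betw_def)
  also have "\<dots> = ?S"
    using bij_betw_affine_mod [OF n, of t] by (simp only: bij_betw_def)
  finally have S_q: "?S [^] q \<otimes> (?\<omega> [^] t) [^] i = ?S" .
  have "(inv ?N \<otimes> ?b [^] i \<otimes> ?S) [^] q = inv ?N [^] q \<otimes> (?b [^] q) [^] i \<otimes> ?S [^] q"
    by (simp add: nat_pow_distrib nat_pow_pow mult.commute [of i q])
  also have "\<dots> = inv ?N \<otimes> ?b [^] i \<otimes> (?S [^] q \<otimes> (?\<omega> [^] t) [^] i)"
    by (simp add: N_q b_q nat_pow_distrib m_ac)
  finally show ?thesis
    using constacyclic_idft_eq [OF N \<xi>U \<beta> A(1)] S_q by simp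
qed

section \<open>Vectors over the subfield characterized by their spectra\<close>

theorem proposition2:
  fixes K :: "('a, 'b) ring_scheme" and F :: "'a set"
    and q n m\<^sub>2 t :: nat and l \<xi> \<beta> :: 'a and A a :: "nat \<Rightarrow> 'a"
  assumes "primepow q" and "n > 0" and "gcd n q = 1"
    and "field K" and "subfield F K" and "card F = q"
    and "l \<in> F - {\<zero>\<^bsub>K\<^esub>}"
    and "m\<^sub>2 = Pocklington.ord (n * mult_order K l) q"
    and "card (carrier K) = q ^ m\<^sub>2"
    and "primitive_root_of_unity K n \<xi>"
    and "\<beta> \<in> carrier K" and "\<beta> [^]\<^bsub>K\<^esub> n = l"
    and "\<forall>j<n. A j \<in> carrier K"
    and "\<forall>i<n. a i = constacyclic_idft K n \<xi> \<beta> A i"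
    and "t < n" and "\<xi> [^]\<^bsub>K\<^esub> t = \<beta> [^]\<^bsub>K\<^esub> (q - 1)"
  shows "(\<forall>i<n. a i \<in> F) \<longleftrightarrow> (\<forall>j<n. A j [^]\<^bsub>K\<^esub> q = A ((q * j + t) mod n))"
proof -
  interpret field K
    by fact
  obtain p k where p: "prime p" and q: "q = p ^ k" and k: "k > 0"
    using \<open>primepow q\<close> by (auto simp: primepow_def)
  have "q > 0"
    using p q by (simp add: prime_gt_0_nat)
  \<comment> \<open>\<open>card\<close> is 0 on infinite sets, so a positive cardinality forces
    finiteness.\<close>
  have finite: "finite (carrier K)"
    using \<open>card (carrier K) = q ^ m\<^sub>2\<close> \<open>q > 0\<close> card_gt_0_iff by fastforce
  have char: "[p] \<cdot>\<^bsub>K\<^esub> \<one>\<^bsub>K\<^esub> = \<zero>\<^bsub>K\<^esub>"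
    using prime_char_of_card [OF p, of "k * m\<^sub>2"] \<open>card (carrier K) = q ^ m\<^sub>2\<close>
    by (simp add: q power_mult)
  have hom: "ring_hom_cring K K (\<lambda>x. x [^]\<^bsub>K\<^esub> q)"
    unfolding q by (rule frobenius_hom [OF p char])
  have coprime: "coprime n q"
    using \<open>gcd n q = 1\<close> by (simp only: coprime_iff_gcd_eq_1)
  \<comment> \<open>As \<open>k > 0\<close>, coprimality with \<open>q = p ^ k\<close> passes down
    to the characteristic \<open>p\<close>.\<close>
  then have N: "[n] \<cdot>\<^bsub>K\<^esub> \<one>\<^bsub>K\<^esub> \<noteq> \<zero>\<^bsub>K\<^esub>"
    using add_pow_one_nonzero [OF char] k q by simp
  have F: "F = {x \<in> carrier K. x [^]\<^bsub>K\<^esub> q = x}"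
    using finite_subfield_fixed_points finite \<open>subfield F K\<close> \<open>card F = q\<close> .
  note \<xi> = \<open>primitive_root_of_unity K n \<xi>\<close>
  have \<xi>c: "\<xi> \<in> carrier K"
    using \<xi> by (simp add: primitive_root_of_unity_def)
  have "\<beta> \<noteq> \<zero>\<^bsub>K\<^esub>"
    using \<open>\<beta> [^]\<^bsub>K\<^esub> n = l\<close> \<open>l \<in> F - {\<zero>\<^bsub>K\<^esub>}\<close> \<open>n > 0\<close> by (auto simp: nat_pow_zero)
  then have \<beta>: "\<beta> \<in> Units K"
    using \<open>\<beta> \<in> carrier K\<close> by (simp add: field_Units)
  \<comment> \<open>The condition on \<open>t\<close> multiplied by \<open>\<beta>\<close>, which
    removes the truncated subtraction in \<open>q - 1\<close>.\<close>
  have t: "\<xi> [^]\<^bsub>K\<^esub> t \<otimes>\<^bsub>K\<^esub> \<beta> = \<beta> [^]\<^bsub>K\<^esub> q"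
    using \<open>\<xi> [^]\<^bsub>K\<^esub> t = \<beta> [^]\<^bsub>K\<^esub> (q - 1)\<close> \<open>q > 0\<close> by (cases q) auto
  have A: "A j \<in> carrier K" if "j < n" for j
    using that \<open>\<forall>j<n. A j \<in> carrier K\<close> by blast
  have a: "a i = constacyclic_idft K n \<xi> \<beta> A i" if "i < n" for i
    using that \<open>\<forall>i<n. a i = constacyclic_idft K n \<xi> \<beta> A i\<close> by blast
  show ?thesis
  proof
    assume aF: "\<forall>i<n. a i \<in> F"
    have dft: "constacyclic_dft K n \<xi> \<beta> a j = A j" if "j < n" for j
    proof -
      \<comment> \<open>\<open>a\<close> is known to agree with the inverse transform only below
        \<open>n\<close>, so it is replaced summand by summand.\<close>
      have "constacyclic_dft K n \<xi> \<beta> a j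
          = constacyclic_dft K n \<xi> \<beta> (constacyclic_idft K n \<xi> \<beta> A) j"
        using aF \<xi>c \<open>\<beta> \<in> carrier K\<close> unfolding constacyclic_dft_def F
        by (intro finsum_cong') (auto simp flip: a)
      then show ?thesis
        using constacyclic_dft_idft [OF N \<xi> \<beta> A that] by simp
    qed
    show "\<forall>j<n. A j [^]\<^bsub>K\<^esub> q = A ((q * j + t) mod n)"
    proof (intro allI impI)
      fix j assume "j < n"
      then have "A j [^]\<^bsub>K\<^esub> q = constacyclic_dft K n \<xi> \<beta> a (q * j + t)"
        using constacyclic_dft_frobenius [OF hom \<xi>c \<open>\<beta> \<in> carrier K\<close> t, of n a j] aF
        by (simp add: dft F)
      also have "\<dots> = constacyclic_dft K n \<xi> \<beta> a ((q * j + t) mod n)"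
        by (intro constacyclic_dft_cong_mod [OF \<xi>]) (simp add: cong_def)
      also have "\<dots> = A ((q * j + t) mod n)"
        using \<open>n > 0\<close> by (intro dft) simp
      finally show "A j [^]\<^bsub>K\<^esub> q = A ((q * j + t) mod n)" .
    qed
  next
    assume Aq: "\<forall>j<n. A j [^]\<^bsub>K\<^esub> q = A ((q * j + t) mod n)"
    have "constacyclic_idft K n \<xi> \<beta> A i \<in> F" for i
    proof -
      have "constacyclic_idft K n \<xi> \<beta> A i \<in> carrier K"
        using constacyclic_idft_closed [OF N _ \<beta> A] \<xi>c \<xi>
        by (simp add: primitive_root_of_unity_def field_Units)
      moreover have "constacyclic_idft K n \<xi> \<beta> A i [^]\<^bsub>K\<^esub> q = constacyclic_idft K n \<xi> \<beta> A i"
        using constacyclic_idft_frobenius [OF hom \<open>n > 0\<close> _ N \<xi> \<beta> t A] coprime Aq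
        by (simp add: coprime_commute)
      ultimately show ?thesis
        by (simp add: F)
    qed
    then show "\<forall>i<n. a i \<in> F"
      by (simp add: a)
  qed
qed

end
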